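(* Let $X_n,Y_n,M_n,P_n$ and $A_n,B_n,C_n$ $(n\ge0)$ be the sequences defined in the context. For all $n\ge0$, $$X_n=B_n-A_n,\qquad Y_n=C_n-B_n,\qquad M_n=C_n-2B_n+A_n,\qquad P_n=C_n-A_n.$$
   Context: $\operatorname{mex}(S)$ is the smallest nonnegative integer not in $S$. Set $X_0=Y_0=M_0=P_0=0$ and, for $n>0$, $X_n=\operatorname{mex}\{X_i,Y_i:i<n\}$, $M_n=\operatorname{mex}\{M_i,P_i:i<n\}$, $Y_n=X_n+M_n$, $P_n=X_n+Y_n$. The Tribonacci word $\mathbf T=t_1t_2t_3\cdots$ (indexed from $1$) is the infinite fixed point, beginning with $a$, of the morphism $\tau: a\to ab,\ b\to ac,\ c\to a$. For $n\ge1$, $A_n$ (resp. $B_n$, $C_n$) is the index of the $n$th occurrence of the letter $a$ (resp. $b$, $c$) in $\mathbf T$; also $A_0=B_0=C_0=0$. *)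

theory Defs
  imports "HOL-Library.Stream" "HOL-Library.Infinite_Set"
begin

definition mex :: "nat set \<Rightarrow> nat" where
  "mex S = (LEAST k. k \<notin> S)"

function X_seq :: "nat \<Rightarrow> nat" and Y_seq :: "nat \<Rightarrow> nat"
  and M_seq :: "nat \<Rightarrow> nat" and P_seq :: "nat \<Rightarrow> nat" where
  "X_seq n = (if n = 0 then 0 else mex (X_seq ` {..<n} \<union> Y_seq ` {..<n}))"
| "M_seq n = (if n = 0 then 0 else mex (M_seq ` {..<n} \<union> P_seq ` {..<n}))"
| "Y_seq n = (if n = 0 then 0 else X_seq n + M_seq n)"
| "P_seq n = (if n = 0 then 0 else X_seq n + Y_seq n)"
  by pat_completeness auto
termination
  by (relation "measure (\<lambda>s. case s of Inl (Inl n) \<Rightarrow> 3 * n | Inl (Inr n) \<Rightarrow> 3 * n + 1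
        | Inr (Inl n) \<Rightarrow> 3 * n | Inr (Inr n) \<Rightarrow> 3 * n + 2)") auto

declare X_seq.simps [simp del] Y_seq.simps [simp del] M_seq.simps [simp del] P_seq.simps [simp del]

datatype letter = La | Lb | Lc

fun tau :: "letter \<Rightarrow> letter list" where
  "tau La = [La, Lb]"
| "tau Lb = [La, Lc]"
| "tau Lc = [La]"

text \<open>The action of the morphism on infinite words; \<^const>\<open>flat\<close> is the infinite
  concatenation since no letter is erased.\<close>

definition tau_stream :: "letter stream \<Rightarrow> letter stream" where
  "tau_stream s = flat (smap tau s)"

definition tribonacci_word :: "letter stream" where
  "tribonacci_word = (THE s. shd s = La \<and> tau_stream s = s)"

text \<open>Streams are indexed from 0, whereas the letters of the word are indexed from 1.\<close>

definition positions :: "letter \<Rightarrow> nat set" where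
  "positions x = {k. k \<ge> 1 \<and> tribonacci_word !! (k - 1) = x}"

text \<open>\<^const>\<open>enumerate\<close> counts from 0, so the \<open>n\<close>th occurrence has number \<open>n - 1\<close>.\<close>

definition occurrence :: "letter \<Rightarrow> nat \<Rightarrow> nat" where
  "occurrence x n = (if n = 0 then 0 else enumerate (positions x) (n - 1))"

definition A_seq :: "nat \<Rightarrow> nat" where "A_seq = occurrence La"
definition B_seq :: "nat \<Rightarrow> nat" where "B_seq = occurrence Lb"
definition C_seq :: "nat \<Rightarrow> nat" where "C_seq = occurrence Lc"

text \<open>The infinite fixed point beginning with \<open>La\<close> exists and is unique, and every letter
  occurs in it infinitely often, so the definite description and the enumerations above
  are meaningful.\<close>

lemma tau_nonempty [simp]: "tau x \<noteq> []"
  by (cases x) auto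

lemma tau_stream_SCons: "tau_stream (x ## s) = tau x @- tau_stream s"
  by (simp add: tau_stream_def)

lemma tau_stream_shift: "tau_stream (xs @- s) = concat (map tau xs) @- tau_stream s"
  by (induction xs) (simp_all add: tau_stream_SCons)

definition tau_iter :: "nat \<Rightarrow> letter list" where
  "tau_iter n = ((\<lambda>w. concat (map tau w)) ^^ n) [La]"

lemma tau_iter_0: "tau_iter 0 = [La]"
  by (simp add: tau_iter_def)

lemma tau_iter_Suc: "tau_iter (Suc n) = concat (map tau (tau_iter n))"
  by (simp add: tau_iter_def)

lemma tau_iter_prefix: "\<exists>v. v \<noteq> [] \<and> tau_iter (Suc n) = tau_iter n @ v"
proof (induction n)
  case 0
  show ?case by (simp add: tau_iter_Suc tau_iter_0)
next
  case (Suc n)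
  then obtain v where v: "v \<noteq> []" "tau_iter (Suc n) = tau_iter n @ v" by blast
  have "tau_iter (Suc (Suc n)) = tau_iter (Suc n) @ concat (map tau v)"
    by (subst tau_iter_Suc, subst v(2)) (simp add: tau_iter_Suc)
  moreover have "concat (map tau v) \<noteq> []"
    using v(1) by (cases v) auto
  ultimately show ?case by blast
qed

lemma tau_iter_length: "n < length (tau_iter n)"
proof (induction n)
  case 0
  show ?case by (simp add: tau_iter_0)
next
  case (Suc n)
  obtain v where "v \<noteq> []" "tau_iter (Suc n) = tau_iter n @ v"
    using tau_iter_prefix by blast
  then show ?case using Suc by (cases v) auto
qed

lemma tau_iter_nth_mono:
  assumes "m \<le> n" "i < length (tau_iter m)"
  shows "i < length (tau_iter n) \<and> tau_iter n ! i = tau_iter m ! i"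
  using assms(1)
proof (induction n rule: dec_induct)
  case base
  show ?case using assms(2) by simp
next
  case (step n)
  then show ?case
    using tau_iter_prefix [of n] by (auto simp: nth_append)
qed

lemma fixed_point_prefix:
  assumes "shd s = La" "tau_stream s = s"
  shows "\<exists>r. s = tau_iter n @- r"
proof (induction n)
  case 0
  show ?case
    using assms(1) by (cases s) (auto simp: tau_iter_0)
next
  case (Suc n)
  then obtain r where "s = tau_iter n @- r" by blast
  then have "s = tau_iter (Suc n) @- tau_stream r"
    by (metis assms(2) tau_stream_shift tau_iter_Suc)
  then show ?case by blast
qed

lemma stream_eq_of_snth:
  assumes "\<And>i. s !! i = t !! i"
  shows "s = t"
proof -
  have "smap (snth s) nats = smap (snth t) nats"
    using assms by (simp cong: stream.map_cong)
  then show ?thesis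
    by (simp only: stream_smap_nats [symmetric])
qed

lemma fixed_point_exists: "\<exists>s. shd s = La \<and> tau_stream s = s"
proof -
  define s where "s = smap (\<lambda>i. tau_iter i ! i) nats"
  have nth: "s !! i = tau_iter n ! i" if "i < length (tau_iter n)" for i n
  proof (cases "i \<le> n")
    case True
    then show ?thesis
      using tau_iter_nth_mono [OF True tau_iter_length] by (simp add: s_def)
  next
    case False
    then show ?thesis
      using tau_iter_nth_mono [of n i i] that by (simp add: s_def)
  qed
  have pre: "s = tau_iter n @- sdrop (length (tau_iter n)) s" for n
  proof -
    have "stake (length (tau_iter n)) s = tau_iter n"
      by (rule nth_equalityI) (simp_all add: nth)
    then show ?thesis by (metis stake_sdrop)
  qed
  have "tau_stream s !! i = s !! i" for i
  proof -
    have "tau_stream s = tau_iter (Suc i) @- tau_stream (sdrop (length (tau_iter i)) s)"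
      by (subst pre [of i]) (simp add: tau_stream_shift tau_iter_Suc)
    moreover have "i < length (tau_iter (Suc i))"
      using tau_iter_length [of "Suc i"] by simp
    ultimately show ?thesis using nth [of i "Suc i"] by simp
  qed
  then have "tau_stream s = s" by (rule stream_eq_of_snth)
  moreover have "shd s = La"
    using nth [of 0 0] by (simp add: tau_iter_0)
  ultimately show ?thesis by blast
qed

lemma fixed_point_unique:
  assumes "shd s = La" "tau_stream s = s" "shd t = La" "tau_stream t = t"
  shows "s = t"
proof (rule stream_eq_of_snth)
  fix i
  obtain r r' where "s = tau_iter i @- r" "t = tau_iter i @- r'"
    using fixed_point_prefix assms by metis
  then show "s !! i = t !! i"
    using tau_iter_length [of i] by simp
qed

lemma tribonacci_word:
  "shd tribonacci_word = La" "tau_stream tribonacci_word = tribonacci_word"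
proof -
  have "\<exists>!s. shd s = La \<and> tau_stream s = s"
    using fixed_point_exists fixed_point_unique by blast
  from theI' [OF this]
  show "shd tribonacci_word = La" "tau_stream tribonacci_word = tribonacci_word"
    by (simp_all add: tribonacci_word_def)
qed

lemma infinite_positions: "infinite (positions x)"
proof -
  let ?f = "\<lambda>w. concat (map tau w)"
  have len: "length w \<le> length (?f w)" for w
  proof (induction w)
    case (Cons y w)
    then show ?case by (cases y) auto
  qed simp
  have "\<exists>k > m. k \<in> positions x" for m
  proof -
    define r where "r = sdrop m tribonacci_word"
    define u where "u = ?f (?f (?f (stake m tribonacci_word)))"
    define h where "h = ?f (?f (tau (shd r)))"
    define q where "q = tau_stream (tau_stream (tau_stream (stl r)))"
    have "tribonacci_word = stake m tribonacci_word @- (shd r ## stl r)"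
      by (metis r_def stake_sdrop stream.collapse)
    then have "tau_stream (tau_stream (tau_stream tribonacci_word)) =
        tau_stream (tau_stream (tau_stream (stake m tribonacci_word @- (shd r ## stl r))))"
      by (rule arg_cong)
    then have eq: "tribonacci_word = u @- h @- q"
      unfolding tribonacci_word(2) tau_stream_shift tau_stream_SCons u_def h_def q_def .
    have "m \<le> length u"
      using len [of "stake m tribonacci_word"] len [of "?f (stake m tribonacci_word)"]
        len [of "?f (?f (stake m tribonacci_word))"]
      by (simp add: u_def)
    have "x \<in> set h"
      unfolding h_def by (cases "shd r"; cases x) auto
    then obtain j where j: "j < length h" "h ! j = x"
      by (auto simp: in_set_conv_nth)
    have "tribonacci_word !! (length u + j) = x"
      by (subst eq) (use j in simp)
    then show ?thesis
      using \<open>m \<le> length u\<close>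
      by (intro exI [of _ "Suc (length u + j)"]) (simp add: positions_def)
  qed
  then show ?thesis by (simp add: infinite_nat_iff_unbounded)
qed

end

theory Submission
  imports Defs
begin

text \<open>
  Let \<open>N\<^sub>U(k)\<close> be the number of letters from \<open>U\<close> among the first \<open>k\<close> letters of the Tribonacci
  word. The map \<open>N\<^sub>a\<^sub>b\<close> sends the positions that carry an \<open>a\<close> or a \<open>b\<close>, that is, the
  \<open>A\<^sub>n\<close> and \<open>B\<^sub>n\<close> with \<open>n \<ge> 1\<close>, increasingly and bijectively onto the positive integers.
  Since \<open>A\<^sub>n < B\<^sub>n\<close> and index 0 contributes the value 0, the least integer missing from the
  values with index below \<open>n\<close> is \<open>N\<^sub>a\<^sub>b(A\<^sub>n)\<close>.
  The same holds for \<open>{a, c}\<close> and \<open>A\<^sub>n < C\<^sub>n\<close>. This is \<open>mex_rank\<close>, and it explains both mex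
  recursions: \<open>X\<^sub>n = N\<^sub>a\<^sub>b(A\<^sub>n)\<close>, \<open>Y\<^sub>n = N\<^sub>a\<^sub>b(B\<^sub>n)\<close>, \<open>M\<^sub>n = N\<^sub>a\<^sub>c(A\<^sub>n)\<close>, \<open>P\<^sub>n = N\<^sub>a\<^sub>c(C\<^sub>n)\<close>.

  It remains to count letters. Because the word is fixed by the morphism, the image of its
  prefix of length \<open>A\<^sub>n\<close> is again a prefix; it ends in the \<open>n\<close>th \<open>b\<close>, so its length is \<open>B\<^sub>n\<close>.
  Likewise the image of the prefix of length \<open>B\<^sub>n\<close> has length \<open>C\<^sub>n\<close>. An image \<open>\<tau>(w)\<close> contains
  as many \<open>a\<close>s as \<open>w\<close> has letters, as many \<open>b\<close>s as \<open>w\<close> has \<open>a\<close>s, and as many \<open>c\<close>s as \<open>w\<close> has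
  \<open>b\<close>s. This expresses all the counts through \<open>n\<close>, \<open>A\<^sub>n\<close> and \<open>N\<^sub>b(A\<^sub>n)\<close>, which gives the
  recursions for \<open>Y\<^sub>n\<close> and \<open>P\<^sub>n\<close> as well as the four claimed identities.
\<close>

section \<open>Counting letters in prefixes and ranking their positions\<close>

text \<open>The number of letters from a given set among the first \<open>k\<close> letters of the word.\<close>

definition cnt :: "letter set \<Rightarrow> nat \<Rightarrow> nat" where
  "cnt U k = length (filter (\<lambda>y. y \<in> U) (stake k tribonacci_word))"

lemma cnt_0 [simp]: "cnt U 0 = 0"
  by (simp add: cnt_def)

lemma cnt_Suc: "cnt U (Suc k) = cnt U k + (if tribonacci_word !! k \<in> U then 1 else 0)"
  by (simp add: cnt_def stake_Suc del: stake.simps(2))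

lemma cnt_mono: "j \<le> k \<Longrightarrow> cnt U j \<le> cnt U k"
  by (induction k rule: dec_induct) (auto simp: cnt_Suc)

lemma cnt_insert: "x \<notin> U \<Longrightarrow> cnt (insert x U) k = cnt {x} k + cnt U k"
  by (induction k) (auto simp: cnt_Suc)

lemma cnt_UNIV: "cnt {La, Lb, Lc} k = k"
proof (induction k)
  case (Suc k)
  then show ?case by (cases "tribonacci_word !! k") (auto simp: cnt_Suc)
qed simp

text \<open>Positions are numbered from 1: position \<open>p\<close> carries the letter with stream index
  \<open>p - 1\<close>, so it is counted by \<open>cnt U p\<close> but not by any earlier count.\<close>

lemma cnt_less_position:
  assumes "j < p" "p \<in> positions x" "x \<in> U"
  shows "cnt U j < cnt U p"
proof -
  obtain q where q: "p = Suc q" using assms(1) by (cases p) auto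
  then show ?thesis
    using assms cnt_mono [of j q U] by (auto simp: positions_def cnt_Suc)
qed

lemma cnt_position_inj:
  assumes "p \<in> positions x" "x \<in> U" "q \<in> positions y" "y \<in> U" "cnt U p = cnt U q"
  shows "p = q"
  using assms cnt_less_position [of p q y U] cnt_less_position [of q p x U]
  by (cases p q rule: linorder_cases) auto

lemma cnt_surj:
  assumes "0 < j" "j \<le> cnt U k"
  shows "\<exists>p x. p \<le> k \<and> x \<in> U \<and> p \<in> positions x \<and> cnt U p = j"
  using assms(2)
proof (induction k)
  case 0
  then show ?case using assms(1) by simp
next
  case (Suc k)
  show ?case
  proof (cases "j \<le> cnt U k")
    case True
    then show ?thesis using Suc.IH le_Suc_eq by blast
  next
    case False
    then have "tribonacci_word !! k \<in> U" "cnt U (Suc k) = j"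
      using Suc.prems by (auto simp: cnt_Suc split: if_splits)
    then show ?thesis
      by (intro exI [of _ "Suc k"] exI [of _ "tribonacci_word !! k"])
        (auto simp: positions_def)
  qed
qed

lemma cnt_eq_card: "cnt {x} k = card {p \<in> positions x. p \<le> k}"
proof (induction k)
  case 0
  have "{p \<in> positions x. p \<le> 0} = {}" by (auto simp: positions_def)
  then show ?case by simp
next
  case (Suc k)
  have "{p \<in> positions x. p \<le> Suc k} =
      (if tribonacci_word !! k = x then insert (Suc k) {p \<in> positions x. p \<le> k}
       else {p \<in> positions x. p \<le> k})"
    by (auto simp: positions_def le_Suc_eq)
  moreover have "finite {p \<in> positions x. p \<le> k}"
    by (rule finite_subset [of _ "{..k}"]) auto
  ultimately show ?case using Suc by (simp add: cnt_Suc)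
qed

lemma occurrence_0 [simp]: "occurrence x 0 = 0"
  by (simp add: occurrence_def)

lemma occurrence_in_positions: "0 < n \<Longrightarrow> occurrence x n \<in> positions x"
  by (simp add: occurrence_def enumerate_in_set infinite_positions)

lemma cnt_occurrence: "cnt {x} (occurrence x n) = n"
proof (cases n)
  case (Suc m)
  let ?e = "enumerate (positions x)"
  have "{p \<in> positions x. p \<le> ?e m} = ?e ` {..m}"
  proof (intro set_eqI iffI)
    fix p assume p: "p \<in> {p \<in> positions x. p \<le> ?e m}"
    then obtain i where "p = ?e i"
      using range_enumerate [OF infinite_positions [of x]] by blast
    then show "p \<in> ?e ` {..m}"
      using p infinite_positions [of x] by (auto simp: enumerate_mono_le_iff)
  qed (auto simp: enumerate_in_set enumerate_mono_le_iff infinite_positions)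
  moreover have "inj_on ?e {..m}"
    using strict_mono_enumerate [OF infinite_positions [of x]]
    by (meson inj_on_subset strict_mono_imp_inj_on subset_UNIV)
  ultimately show ?thesis
    by (simp add: Suc occurrence_def cnt_eq_card card_image)
qed simp

lemma occurrence_cnt:
  assumes "p \<in> positions x"
  shows "occurrence x (cnt {x} p) = p"
proof -
  have "0 < cnt {x} p"
    using assms cnt_less_position [of 0 p x "{x}"] by (auto simp: positions_def)
  then show ?thesis
    using cnt_position_inj [of "occurrence x (cnt {x} p)" x "{x}" p x] assms
    by (simp add: occurrence_in_positions cnt_occurrence)
qed

section \<open>The mex recursion\<close>

text \<open>Ranking the positions of two letters solves the mex recursion, provided that the
  \<open>n\<close>th \<open>x\<close> comes before the \<open>n\<close>th \<open>y\<close>. The terms with index 0 contribute the value 0.\<close>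

lemma mex_rank:
  assumes "0 < n" "occurrence x n < occurrence y n"
  shows "mex ((\<lambda>i. cnt {x, y} (occurrence x i)) ` {..<n} \<union>
              (\<lambda>i. cnt {x, y} (occurrence y i)) ` {..<n}) = cnt {x, y} (occurrence x n)"
    (is "mex ?S = ?r")
  unfolding mex_def
proof (rule Least_equality)
  have xn: "occurrence x n \<in> positions x"
    using assms(1) by (rule occurrence_in_positions)
  have "0 < occurrence x n" using xn by (simp add: positions_def)
  then have pos: "0 < ?r"
    using cnt_less_position [OF _ xn, of 0 "{x, y}"] by simp
  have ne: "cnt {x, y} (occurrence z i) \<noteq> ?r" if i: "i < n" and z: "z \<in> {x, y}" for z i
  proof (cases "i = 0")
    case False
    show ?thesis
    proof
      assume "cnt {x, y} (occurrence z i) = ?r"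
      moreover have zi: "occurrence z i \<in> positions z"
        using False by (simp add: occurrence_in_positions)
      ultimately have eq: "occurrence z i = occurrence x n"
        using cnt_position_inj [OF zi z xn] by simp
      then have "z = x" using zi xn by (simp add: positions_def)
      then show False using eq i cnt_occurrence [of x i] cnt_occurrence [of x n] by simp
    qed
  qed (use pos in simp)
  then show "?r \<notin> ?S" by fastforce
  fix k assume k: "k \<notin> ?S"
  show "?r \<le> k"
  proof (rule ccontr)
    assume less: "\<not> ?r \<le> k"
    \<comment> \<open>Such a \<open>k\<close> is the rank of a position \<open>p\<close> before the \<open>n\<close>th \<open>x\<close>, hence also before the
      \<open>n\<close>th \<open>y\<close>, so \<open>p\<close> is an occurrence with index below \<open>n\<close>.\<close>
    have "k \<noteq> 0" using k assms(1) by force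
    then obtain p z where p: "p \<le> occurrence x n" "z \<in> {x, y}" "p \<in> positions z"
        "cnt {x, y} p = k"
      using cnt_surj [of k "{x, y}" "occurrence x n"] less by auto
    define i where "i = cnt {z} p"
    have zi: "occurrence z i = p" using p(3) by (simp add: i_def occurrence_cnt)
    have "p < occurrence x n" using p less by (cases "p = occurrence x n") auto
    then have "p < occurrence z n" using p(2) assms(2) by auto
    then have "cnt {z} p < cnt {z} (occurrence z n)"
      using cnt_less_position [of p "occurrence z n" z "{z}"] assms(1)
      by (simp add: occurrence_in_positions)
    then have "i < n" by (simp add: i_def cnt_occurrence)
    then show False using k p(2,4) zi by auto
  qed
qed

section \<open>Images of prefixes under the morphism\<close>

text \<open>The length of the image under the morphism of the prefix of length \<open>k\<close>.\<close>

definition image_length :: "nat \<Rightarrow> nat" where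
  "image_length k = length (concat (map tau (stake k tribonacci_word)))"

lemma stake_image_length:
  "stake (image_length k) tribonacci_word = concat (map tau (stake k tribonacci_word))"
proof -
  have "tau_stream (stake k tribonacci_word @- sdrop k tribonacci_word) = tribonacci_word"
    by (simp only: stake_sdrop tribonacci_word(2))
  then have "stake (image_length k) tribonacci_word =
      stake (image_length k) (concat (map tau (stake k tribonacci_word)) @-
        tau_stream (sdrop k tribonacci_word))"
    by (simp only: tau_stream_shift)
  then show ?thesis by (simp add: stake_shift image_length_def)
qed

lemma cnt_image_length:
  "cnt {La} (image_length k) = k"
  "cnt {Lb} (image_length k) = cnt {La} k"
  "cnt {Lc} (image_length k) = cnt {Lb} k"
proof -
  have "length (filter (\<lambda>y. y \<in> {La}) (concat (map tau w))) = length w \<and>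
      length (filter (\<lambda>y. y \<in> {Lb}) (concat (map tau w))) =
        length (filter (\<lambda>y. y \<in> {La}) w) \<and>
      length (filter (\<lambda>y. y \<in> {Lc}) (concat (map tau w))) =
        length (filter (\<lambda>y. y \<in> {Lb}) w)" for w
  proof (induction w)
    case (Cons x w)
    then show ?case by (cases x) auto
  qed simp
  then show "cnt {La} (image_length k) = k"
    "cnt {Lb} (image_length k) = cnt {La} k"
    "cnt {Lc} (image_length k) = cnt {Lb} k"
    unfolding cnt_def stake_image_length by simp_all
qed

text \<open>The image of a prefix ending in \<open>x\<close> ends in the last letter of \<open>\<tau>(x)\<close>.\<close>

lemma image_length_in_positions:
  assumes "p \<in> positions x"
  shows "image_length p \<in> positions (last (tau x))"
proof -
  obtain q where q: "p = Suc q" "tribonacci_word !! q = x"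
    using assms by (cases p) (auto simp: positions_def)
  have "concat (map tau (stake p tribonacci_word)) =
      concat (map tau (stake q tribonacci_word)) @ tau x"
    using q by (simp add: stake_Suc del: stake.simps(2))
  then have st: "stake (image_length p) tribonacci_word =
      concat (map tau (stake q tribonacci_word)) @ tau x"
    by (simp add: stake_image_length)
  then have len: "image_length p = length (concat (map tau (stake q tribonacci_word)) @ tau x)"
    by (metis length_stake)
  then have pos: "image_length p > 0" by simp
  then have "tribonacci_word !! (image_length p - 1) =
      last (stake (image_length p) tribonacci_word)"
    by (metis Suc_pred' last_snoc stake_Suc)
  then show ?thesis using st pos by (simp add: positions_def)
qed

text \<open>The image of the prefix of length \<open>A\<^sub>n\<close> ends in a \<open>b\<close> and contains \<open>n\<close> letters \<open>b\<close> if \<open>n > 0\<close>.\<close>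

lemma B_seq_eq_image_length: "B_seq n = image_length (A_seq n)"
proof (cases "n = 0")
  case True
  then show ?thesis by (simp add: A_seq_def B_seq_def image_length_def)
next
  case False
  then have "image_length (A_seq n) \<in> positions Lb"
    using image_length_in_positions [OF occurrence_in_positions, of n La]
    by (simp add: A_seq_def)
  from occurrence_cnt [OF this] show ?thesis
    by (simp add: A_seq_def B_seq_def cnt_image_length cnt_occurrence)
qed

lemma C_seq_eq_image_length: "C_seq n = image_length (B_seq n)"
proof (cases "n = 0")
  case True
  then show ?thesis by (simp add: B_seq_def C_seq_def image_length_def)
next
  case False
  then have "image_length (B_seq n) \<in> positions Lc"
    using image_length_in_positions [OF occurrence_in_positions, of n Lb]
    by (simp add: B_seq_def)
  from occurrence_cnt [OF this] show ?thesis
    by (simp add: B_seq_def C_seq_def cnt_image_length cnt_occurrence)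
qed

lemma cnt_split:
  "cnt {La, Lb} k = cnt {La} k + cnt {Lb} k"
  "cnt {La, Lc} k = cnt {La} k + cnt {Lc} k"
  "k = cnt {La} k + cnt {Lb} k + cnt {Lc} k"
  using cnt_UNIV [of k] cnt_insert [of La "{Lb}" k] cnt_insert [of La "{Lc}" k]
    cnt_insert [of La "{Lb, Lc}" k] cnt_insert [of Lb "{Lc}" k]
  by simp_all

lemma cnt_A_B_C:
  "cnt {La} (A_seq n) = n"
  "cnt {La} (B_seq n) = A_seq n" "cnt {Lb} (B_seq n) = n" "cnt {Lc} (B_seq n) = cnt {Lb} (A_seq n)"
  "cnt {La} (C_seq n) = B_seq n" "cnt {Lb} (C_seq n) = A_seq n" "cnt {Lc} (C_seq n) = n"
proof -
  show A: "cnt {La} (A_seq n) = n" by (simp add: A_seq_def cnt_occurrence)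
  show B: "cnt {La} (B_seq n) = A_seq n" "cnt {Lb} (B_seq n) = n"
    "cnt {Lc} (B_seq n) = cnt {Lb} (A_seq n)"
    by (simp_all add: B_seq_eq_image_length cnt_image_length A)
  show "cnt {La} (C_seq n) = B_seq n" "cnt {Lb} (C_seq n) = A_seq n" "cnt {Lc} (C_seq n) = n"
    by (simp_all add: C_seq_eq_image_length cnt_image_length B)
qed

lemma B_seq_decomp: "B_seq n = A_seq n + n + cnt {Lb} (A_seq n)"
  using cnt_split(3) [of "B_seq n"] cnt_A_B_C [of n] by linarith

lemma C_seq_decomp: "C_seq n = B_seq n + A_seq n + n"
  using cnt_split(3) [of "C_seq n"] cnt_A_B_C [of n] by linarith

lemma two_letter_counts:
  "cnt {La, Lb} (A_seq n) = n + cnt {Lb} (A_seq n)"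
  "cnt {La, Lb} (B_seq n) = A_seq n + n"
  "cnt {La, Lc} (A_seq n) + cnt {Lb} (A_seq n) = A_seq n"
  "cnt {La, Lc} (C_seq n) = B_seq n + n"
  using cnt_split(3) [of "A_seq n"] cnt_A_B_C [of n]
  unfolding cnt_split(1,2) by linarith+

section \<open>Identification of the sequences\<close>

lemma seqs_eq_cnt:
  "X_seq n = cnt {La, Lb} (A_seq n) \<and> Y_seq n = cnt {La, Lb} (B_seq n) \<and>
   M_seq n = cnt {La, Lc} (A_seq n) \<and> P_seq n = cnt {La, Lc} (C_seq n)"
proof (induction n rule: less_induct)
  case (less n)
  show ?case
  proof (cases "n = 0")
    case True
    then show ?thesis
      by (simp add: X_seq.simps Y_seq.simps M_seq.simps P_seq.simps
          A_seq_def B_seq_def C_seq_def)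
  next
    case False
    then have n: "0 < n" by simp
    have im: "X_seq ` {..<n} = (\<lambda>i. cnt {La, Lb} (A_seq i)) ` {..<n}"
      "Y_seq ` {..<n} = (\<lambda>i. cnt {La, Lb} (B_seq i)) ` {..<n}"
      "M_seq ` {..<n} = (\<lambda>i. cnt {La, Lc} (A_seq i)) ` {..<n}"
      "P_seq ` {..<n} = (\<lambda>i. cnt {La, Lc} (C_seq i)) ` {..<n}"
      using less by (auto intro!: image_cong)
    \<comment> \<open>The order of the \<open>n\<close>th occurrences that \<open>mex_rank\<close> requires.\<close>
    have "A_seq n < B_seq n" "A_seq n < C_seq n"
      using n by (simp_all add: B_seq_decomp C_seq_decomp)
    then have X: "X_seq n = cnt {La, Lb} (A_seq n)"
      and M: "M_seq n = cnt {La, Lc} (A_seq n)"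
      using n mex_rank [of n La Lb] mex_rank [of n La Lc]
      by (simp_all add: X_seq.simps [of n] M_seq.simps [of n] im
          A_seq_def B_seq_def C_seq_def)
    have Y: "Y_seq n = cnt {La, Lb} (B_seq n)"
      using n two_letter_counts [of n] by (simp add: Y_seq.simps [of n] X M)
    have P: "P_seq n = cnt {La, Lc} (C_seq n)"
      using n two_letter_counts [of n] B_seq_decomp [of n]
      by (simp add: P_seq.simps [of n] X Y)
    from X Y M P show ?thesis by blast
  qed
qed

theorem corollary21:
  fixes n :: nat
  shows "int (X_seq n) = int (B_seq n) - int (A_seq n)
    \<and> int (Y_seq n) = int (C_seq n) - int (B_seq n)
    \<and> int (M_seq n) = int (C_seq n) - 2 * int (B_seq n) + int (A_seq n)
    \<and> int (P_seq n) = int (C_seq n) - int (A_seq n)"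
  using seqs_eq_cnt [of n] two_letter_counts [of n] B_seq_decomp [of n] C_seq_decomp [of n]
  by linarith

end
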